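(* Let $\gamma>-1/2$ and $n\ge4$. For the eigenvalue problem $D^4u=\lambda D^2u$ on $-1\le x\le1$ with $u(\pm1)=Du(\pm1)=0$, the modified Gegenbauer tau method of index $\gamma$ and degree $n$ is equivalent to the Gegenbauer Galerkin method of index $\gamma$ and degree $n$; that is, for every $\lambda\in\mathbb{C}$ and every nonzero polynomial $u_n$ of degree at most $n$, the pair $(\lambda,u_n)$ is a solution of the Galerkin method if and only if there is a polynomial $v_n$ of degree at most $n$ such that $(\lambda,u_n,v_n)$ is a solution of the modified tau method.
   Context: $D=d/dx$, and $W^{(\gamma)}(x)=(1-x^2)^{\gamma-1/2}$ on $(-1,1)$. $G_k^{(\gamma)}$ denotes the Gegenbauer polynomial of degree $k$, orthogonal on $(-1,1)$ with respect to $W^{(\gamma)}$. Gegenbauer Galerkin method (index $\gamma$, degree $n$): $(\lambda,u_n)$, with $u_n$ a polynomial of degree at most $n$, is a solution if $u_n(\pm1)=Du_n(\pm1)=0$ and the residual $\lambda D^2u_n-D^4u_n$ is orthogonal, with respect to $W^{(\gamma)}$, to all polynomials of degree at most $n$ that vanish together with their first derivative at $x=\pm1$, i.e. $$\int_{-1}^1\big(\lambda D^2u_n-D^4u_n\big)(1-x^2)^2q(x)\,W^{(\gamma)}(x)\,dx=0\quad\text{for all polynomials } q \text{ of degree at most } n-4.$$ Modified Gegenbauer tau method (index $\gamma$, degree $n$): the problem is written as $D^2u=v$, $D^2v=\lambda v$, with $u=Du=0$ at $x=\pm1$, and both $u$ and $v$ are approximated by polynomials $u_n,v_n$ of degree at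 most $n$. $(\lambda,u_n,v_n)$ is a solution if $u_n(\pm1)=Du_n(\pm1)=0$ and the residuals of both equations are orthogonal with respect to $W^{(\gamma)}$ to $G_0^{(\gamma)},\dots,G_{n-2}^{(\gamma)}$, i.e. $$\int_{-1}^1\big(D^2u_n-v_n\big)G_k^{(\gamma)}W^{(\gamma)}dx=0,\qquad \int_{-1}^1\big(D^2v_n-\lambda v_n\big)G_k^{(\gamma)}W^{(\gamma)}dx=0,\qquad 0\le k\le n-2.$$ Equivalently, writing $\hat v_k$, $\hat u_k^{(2)}$, $\hat v_k^{(2)}$ for the coefficients of $v_n$, $D^2u_n$, $D^2v_n$ in the basis $G_k^{(\gamma)}$, one requires $\hat u^{(2)}_k=\hat v_k$ and $\hat v_k^{(2)}=\lambda\hat v_k$ for $0\le k\le n-2$. *)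

theory Defs
  imports "HOL-Analysis.Analysis" "HOL-Computational_Algebra.Polynomial"
begin

definition geg_weight :: "real \<Rightarrow> real \<Rightarrow> real" where
  "geg_weight \<gamma> x = (1 - x\<^sup>2) powr (\<gamma> - 1/2)"

text \<open>The weighted integral over \<open>(-1, 1)\<close>, for real- as well as complex-valued \<open>f\<close>. The pairings
  below are bilinear: no complex conjugation is involved.\<close>

definition geg_int :: "real \<Rightarrow> (real \<Rightarrow> 'a::{banach, second_countable_topology}) \<Rightarrow> 'a" where
  "geg_int \<gamma> f = (LINT x:{-1<..<1}|lborel. geg_weight \<gamma> x *\<^sub>R f x)"

text \<open>The Gegenbauer polynomials of index \<open>\<gamma>\<close>, up to normalization: orthogonality and
  \<open>deg G\<^sub>k = k\<close> determine each of them up to a nonzero factor, and no factor is singled out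
  (the usual normalization degenerates at \<open>\<gamma> = 0\<close>). Note that \<^term>\<open>degree 0 = 0\<close> for the zero
  polynomial, so that it has to be excluded separately.\<close>

definition gegenbauer_polys :: "real \<Rightarrow> (nat \<Rightarrow> real poly) \<Rightarrow> bool" where
  "gegenbauer_polys \<gamma> G \<longleftrightarrow>
     (\<forall>k. G k \<noteq> 0 \<and> degree (G k) = k) \<and>
     (\<forall>j k. j \<noteq> k \<longrightarrow> geg_int \<gamma> (\<lambda>x. poly (G j) x * poly (G k) x) = 0)"

definition clamped :: "complex poly \<Rightarrow> bool" where
  "clamped u \<longleftrightarrow> poly u 1 = 0 \<and> poly u (-1) = 0 \<and> poly (pderiv u) 1 = 0 \<and> poly (pderiv u) (-1) = 0"

definition galerkin_solution :: "real \<Rightarrow> nat \<Rightarrow> complex \<Rightarrow> complex poly \<Rightarrow> bool" where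
  "galerkin_solution \<gamma> n lam u \<longleftrightarrow>
     degree u \<le> n \<and> clamped u \<and>
     (\<forall>w. degree w \<le> n \<and> clamped w \<longrightarrow>
        geg_int \<gamma> (\<lambda>x. poly (smult lam ((pderiv ^^ 2) u) - (pderiv ^^ 4) u) (of_real x)
                        * poly w (of_real x)) = 0)"

definition modified_tau_solution ::
  "real \<Rightarrow> (nat \<Rightarrow> real poly) \<Rightarrow> nat \<Rightarrow> complex \<Rightarrow> complex poly \<Rightarrow> complex poly \<Rightarrow> bool" where
  "modified_tau_solution \<gamma> G n lam u v \<longleftrightarrow>
     degree u \<le> n \<and> degree v \<le> n \<and> clamped u \<and>
     (\<forall>k\<le>n - 2.
        geg_int \<gamma> (\<lambda>x. poly ((pderiv ^^ 2) u - v) (of_real x) * of_real (poly (G k) x)) = 0 \<and>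
        geg_int \<gamma> (\<lambda>x. poly ((pderiv ^^ 2) v - smult lam v) (of_real x) * of_real (poly (G k) x)) = 0)"

text \<open>The test functions of the Galerkin method are exactly the \<open>(1 - x\<^sup>2)\<^sup>2 q\<close> with
  \<open>deg q \<le> n - 4\<close>.\<close>

lemma double_root_dvd:
  fixes w :: "complex poly"
  assumes "poly w a = 0" "poly (pderiv w) a = 0"
  shows "[:-a, 1:]\<^sup>2 dvd w"
proof -
  from assms(1) obtain r where r: "w = [:-a, 1:] * r"
    by (auto simp: poly_eq_0_iff_dvd dvd_def)
  have "pderiv w = r + [:-a, 1:] * pderiv r"
    unfolding r by (subst pderiv_mult) (simp add: pderiv_pCons)
  then have "poly r a = 0" using assms(2) by simp
  then have "[:-a, 1:] dvd r" by (simp add: poly_eq_0_iff_dvd)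
  then show ?thesis unfolding r power2_eq_square by (rule mult_dvd_mono[OF dvd_refl])
qed

lemma clamped_iff:
  assumes "n \<ge> 4"
  shows "degree w \<le> n \<and> clamped w \<longleftrightarrow> (\<exists>q. degree q \<le> n - 4 \<and> w = [:1, 0, -1:]\<^sup>2 * q)"
proof
  assume w: "degree w \<le> n \<and> clamped w"
  obtain r where r: "w = [:-1, 1:]\<^sup>2 * r"
    using w double_root_dvd[of w 1] by (auto simp: clamped_def dvd_def)
  have r1: "poly r (-1) = 0"
    using w unfolding clamped_def r by simp
  have "poly (pderiv w) (-1) = poly (pderiv ([:-1, 1:]\<^sup>2)) (-1) * poly r (-1) + 4 * poly (pderiv r) (-1)"
    unfolding r by (subst pderiv_mult) simp
  then have "poly (pderiv r) (-1) = 0"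
    using w r1 by (simp add: clamped_def)
  then obtain t where t: "r = [:1, 1:]\<^sup>2 * t"
    using r1 double_root_dvd[of r "-1"] by (auto simp: dvd_def)
  have "[:1, 0, -1:]\<^sup>2 = [:-1, 1:]\<^sup>2 * [:1, 1 :: complex:]\<^sup>2"
    by (simp add: power2_eq_square)
  then have "w = [:1, 0, -1:]\<^sup>2 * t" unfolding r t by (simp add: mult.assoc)
  then obtain q where q: "w = [:1, 0, -1:]\<^sup>2 * q" by blast
  have "degree q \<le> n - 4"
  proof (cases "q = 0")
    case False
    then have "degree w = 4 + degree q"
      unfolding q by (subst degree_mult_eq) (simp_all add: degree_power_eq)
    then show ?thesis using w by linarith
  qed simp
  with q show "\<exists>q. degree q \<le> n - 4 \<and> w = [:1, 0, -1:]\<^sup>2 * q" by blast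
next
  assume "\<exists>q. degree q \<le> n - 4 \<and> w = [:1, 0, -1:]\<^sup>2 * q"
  then obtain q where q: "degree q \<le> n - 4" "w = [:1, 0, -1:]\<^sup>2 * q" by blast
  have "degree w \<le> degree ([:1, 0, -1 :: complex:]\<^sup>2) + degree q"
    unfolding q by (rule degree_mult_le)
  also have "degree ([:1, 0, -1 :: complex:]\<^sup>2) = 4" by (simp add: degree_power_eq)
  finally have "degree w \<le> n" using q assms by simp
  moreover have "poly (pderiv w) x = poly (pderiv ([:1, 0, -1:]\<^sup>2)) x * poly q x
      + (1 - x\<^sup>2)\<^sup>2 * poly (pderiv q) x" for x
    unfolding q by (subst pderiv_mult) (simp add: power2_eq_square algebra_simps)
  then have "clamped w"
    unfolding clamped_def using q by (simp add: power2_eq_square pderiv_pCons)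
  ultimately show "degree w \<le> n \<and> clamped w" by simp
qed

lemma galerkin_solution_iff:
  assumes "n \<ge> 4"
  shows "galerkin_solution \<gamma> n lam u \<longleftrightarrow>
     degree u \<le> n \<and> clamped u \<and>
     (\<forall>q. degree q \<le> n - 4 \<longrightarrow>
        geg_int \<gamma> (\<lambda>x. poly (smult lam ((pderiv ^^ 2) u) - (pderiv ^^ 4) u) (of_real x)
                        * ((1 - (of_real x)\<^sup>2)\<^sup>2 * poly q (of_real x))) = 0)"
proof -
  have *: "poly ([:1, 0, -1:]\<^sup>2 * q) x = (1 - x\<^sup>2)\<^sup>2 * poly q x" for q and x :: complex
    by (simp add: power2_eq_square algebra_simps)
  show ?thesis
    unfolding galerkin_solution_def clamped_iff[OF assms] *[symmetric] by blast
qed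

text \<open>For \<open>\<gamma> > -1/2\<close> the weighted integrals of continuous functions exist, and so do the
  Gegenbauer polynomials (by Gram-Schmidt).\<close>

lemma set_integrable_geg_weight:
  assumes "\<gamma> > -1/2"
  shows "set_integrable lborel {-1<..<1} (geg_weight \<gamma>)"
proof -
  define a where "a = \<gamma> - 1/2"
  have "((\<lambda>t. t powr a * (1 - t) powr a) has_integral Beta (\<gamma> + 1/2) (\<gamma> + 1/2)) (cbox 0 1)"
    using has_integral_Beta_real[of "\<gamma> + 1/2" "\<gamma> + 1/2"] assms by (simp add: a_def)
  from has_integral_affinity'[OF this, of "1/2" "1/2"]
  have "(\<lambda>x. (x/2 + 1/2) powr a * (1 - (x/2 + 1/2)) powr a) integrable_on {-1..1}"
    by (auto simp: integrable_on_def)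
  then have "(\<lambda>x. 4 powr a * ((x/2 + 1/2) powr a * (1 - (x/2 + 1/2)) powr a)) integrable_on {-1..1}"
    by (rule integrable_on_mult_right)
  moreover have "geg_weight \<gamma> x = 4 powr a * ((x/2 + 1/2) powr a * (1 - (x/2 + 1/2)) powr a)"
    if "x \<in> {-1..1}" for x
  proof -
    have "geg_weight \<gamma> x = (4 * ((x/2 + 1/2) * (1 - (x/2 + 1/2)))) powr a"
      unfolding geg_weight_def a_def by (rule arg_cong2[of _ _ _ _ "(powr)"]) (auto simp: field_simps power2_eq_square)
    also have "\<dots> = 4 powr a * ((x/2 + 1/2) powr a * (1 - (x/2 + 1/2)) powr a)"
      using that by (subst powr_mult) (auto simp: powr_mult mult_nonneg_nonneg)
    finally show ?thesis .
  qed
  ultimately have "geg_weight \<gamma> integrable_on {-1..1}"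
    by (subst integrable_cong)
  then have "geg_weight \<gamma> integrable_on {-1<..<1}" by (simp add: integrable_on_Icc_iff_Ioo)
  then have "geg_weight \<gamma> absolutely_integrable_on {-1<..<1}"
    by (rule nonnegative_absolutely_integrable_1) (simp add: geg_weight_def)
  moreover have "(\<lambda>x. indicator {-1<..<1} x *\<^sub>R geg_weight \<gamma> x) \<in> borel_measurable borel"
    unfolding geg_weight_def by measurable
  ultimately show ?thesis
    unfolding set_integrable_def by (simp add: integrable_completion)
qed

lemma set_integrable_geg_int:
  fixes f :: "real \<Rightarrow> 'a::euclidean_space"
  assumes "\<gamma> > -1/2" "continuous_on UNIV f"
  shows "set_integrable lborel {-1<..<1} (\<lambda>x. geg_weight \<gamma> x *\<^sub>R f x)"
proof -
  have "bounded (f ` {-1..1})"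
    using assms by (intro compact_imp_bounded compact_continuous_image) (auto intro: continuous_on_subset)
  then obtain B where B: "\<And>x. x \<in> {-1..1} \<Longrightarrow> norm (f x) \<le> B"
    unfolding bounded_iff by blast
  have [measurable]: "f \<in> borel_measurable borel"
    using assms(2) by (rule borel_measurable_continuous_onI)
  have [measurable]: "geg_weight \<gamma> \<in> borel_measurable borel"
    unfolding geg_weight_def by measurable
  have "set_integrable lborel {-1<..<1} (\<lambda>x. B * geg_weight \<gamma> x)"
    using set_integrable_geg_weight[OF assms(1)] by (rule set_integrable_mult_right)
  then show ?thesis
  proof (rule set_integrable_bound)
    show "set_borel_measurable lborel {-1<..<1} (\<lambda>x. geg_weight \<gamma> x *\<^sub>R f x)"
      by (simp add: set_borel_measurable_def)
    have "norm (geg_weight \<gamma> x *\<^sub>R f x) \<le> norm (B * geg_weight \<gamma> x)" if "x \<in> {-1<..<1}" for x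
    proof -
      have "norm (geg_weight \<gamma> x *\<^sub>R f x) = norm (f x) * geg_weight \<gamma> x"
        by (simp add: geg_weight_def mult.commute)
      also have "\<dots> \<le> B * geg_weight \<gamma> x"
        using B[of x] that by (intro mult_right_mono) (auto simp: geg_weight_def)
      also have "\<dots> \<le> norm (B * geg_weight \<gamma> x)" by simp
      finally show ?thesis .
    qed
    then show "AE x in lborel. x \<in> {-1<..<1} \<longrightarrow> norm (geg_weight \<gamma> x *\<^sub>R f x) \<le> norm (B * geg_weight \<gamma> x)"
      by simp
  qed
qed

lemma geg_int_square_eq_0:
  assumes "\<gamma> > -1/2" "geg_int \<gamma> (\<lambda>x. poly p x * poly p x) = 0"
  shows "p = (0 :: real poly)"
proof (rule ccontr)
  assume "p \<noteq> 0"
  have "set_integrable lborel {-1<..<1} (\<lambda>x. geg_weight \<gamma> x *\<^sub>R (poly p x * poly p x))"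
    using assms(1) by (rule set_integrable_geg_int) (intro continuous_intros)
  then have "AE x in lborel. indicator {-1<..<1} x *\<^sub>R geg_weight \<gamma> x *\<^sub>R (poly p x * poly p x) = 0"
    using assms(2) unfolding geg_int_def set_lebesgue_integral_def set_integrable_def
    by (subst (asm) integral_nonneg_eq_0_iff_AE) (simp_all add: geg_weight_def)
  moreover have "AE x in lborel. x \<notin> {x. poly p x = 0}"
    by (intro AE_not_in finite_imp_null_set_lborel poly_roots_finite \<open>p \<noteq> 0\<close>)
  ultimately have "AE x in lborel. x \<notin> {-1<..<1 :: real}"
  proof eventually_elim
    case (elim x)
    show ?case
    proof
      assume x: "x \<in> {-1<..<1}"
      then have "\<bar>x\<bar> < 1" by auto
      then have "1 - x\<^sup>2 \<noteq> 0" by (simp add: abs_square_eq_1)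
      with elim x show False by (simp add: geg_weight_def)
    qed
  qed
  then have "emeasure lborel {-1<..<1 :: real} = 0" by (subst (asm) AE_iff_measurable[of "{-1<..<1}"]) auto
  then show False by simp
qed

lemma ex_gegenbauer_polys:
  assumes "\<gamma> > -1/2"
  shows "\<exists>G. gegenbauer_polys \<gamma> G"
proof -
  define B :: "real poly \<Rightarrow> real poly \<Rightarrow> real" where "B p q = geg_int \<gamma> (\<lambda>x. poly p x * poly q x)" for p q
  have int: "set_integrable lborel {-1<..<1} (\<lambda>x. geg_weight \<gamma> x *\<^sub>R (poly p x * poly q x))" for p q
    using assms by (rule set_integrable_geg_int) (intro continuous_intros)
  have comm: "B p q = B q p" for p q
    by (simp add: B_def mult.commute)
  have add: "B (p + q) r = B p r + B q r" for p q r
    unfolding B_def geg_int_def using set_integral_add(2)[OF int[of p r] int[of q r]]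
    by (simp add: algebra_simps)
  have smult: "B (smult c p) r = c * B p r" for c p r
  proof -
    have "B (smult c p) r = (LINT x:{-1<..<1}|lborel. c * (geg_weight \<gamma> x *\<^sub>R (poly p x * poly r x)))"
      unfolding B_def geg_int_def by (simp add: mult_ac)
    also have "\<dots> = c * B p r"
      unfolding B_def geg_int_def by (rule set_integral_mult_right)
    finally show ?thesis .
  qed
  have zero: "B 0 r = 0" for r using smult[of 0 0 r] by simp
  have sum: "B (\<Sum>j<m. f j) r = (\<Sum>j<m. B (f j) r)" for f r and m :: nat
    by (induction m) (simp_all add: zero add)
  define P where "P n p \<longleftrightarrow> degree p = n \<and> lead_coeff p = 1 \<and> (\<forall>q. degree q < n \<longrightarrow> B p q = 0)" for n p
  have "\<exists>p. P n p" for n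
  proof (induction n rule: less_induct)
    case (less n)
    then have "\<forall>j. \<exists>p. j < n \<longrightarrow> P j p" by blast
    from choice[OF this] obtain G where G: "P j (G j)" if "j < n" for j by blast
    have nz: "B (G j) (G j) \<noteq> 0" if "j < n" for j
      using geg_int_square_eq_0[OF assms, of "G j"] G[OF that] by (auto simp: B_def P_def)
    have orth: "B (G j) (G k) = 0" if "j < n" "k < n" "j \<noteq> k" for j k
      using G[OF that(1)] G[OF that(2)] that(3) comm[of "G j" "G k"]
      by (cases j k rule: linorder_cases) (auto simp: P_def)
    define s where "s = (\<Sum>j<n. smult (- B (monom 1 n) (G j) / B (G j) (G j)) (G j))"
    define p where "p = monom 1 n + s"
    have cs: "coeff s i = 0" if "i \<ge> n" for i
      unfolding s_def using G that by (auto simp: coeff_sum P_def intro!: sum.neutral coeff_eq_0)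
    have "degree p \<le> n" by (rule degree_le) (use cs in \<open>auto simp: p_def\<close>)
    moreover have cn: "coeff p n = 1" using cs by (simp add: p_def)
    ultimately have dp: "degree p = n" using le_degree[of p n] by simp
    have pG: "B p (G k) = 0" if "k < n" for k
    proof -
      have "B s (G k) = (\<Sum>j<n. (- B (monom 1 n) (G j) / B (G j) (G j)) * B (G j) (G k))"
        unfolding s_def sum smult ..
      also have "\<dots> = (\<Sum>j<n. if j = k then - B (monom 1 n) (G k) else 0)"
        using nz that orth by (intro sum.cong) auto
      also have "\<dots> = - B (monom 1 n) (G k)" using that by simp
      finally show ?thesis by (simp add: p_def add)
    qed
    have "B p q = 0" if "m \<le> n" "\<And>i. i \<ge> m \<Longrightarrow> coeff q i = 0" for q m
      using that
    proof (induction m arbitrary: q)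
      case 0
      then have "q = 0" by (intro poly_eqI) simp
      then show ?case by (simp add: comm[of p] zero)
    next
      case (Suc m)
      define r where "r = q + smult (- coeff q m) (G m)"
      have Gm: "degree (G m) = m" "coeff (G m) m = 1" using G[of m] Suc.prems by (auto simp: P_def)
      have "coeff r i = 0" if "i \<ge> m" for i
        using that Suc.prems(2)[of i] Gm coeff_eq_0[of "G m" i] by (cases "i = m") (auto simp: r_def)
      then have "B r p = 0" using Suc comm[of p r] by simp
      moreover have "B (G m) p = 0" using pG[of m] Suc.prems comm[of p] by simp
      moreover have "B r p = B q p + - coeff q m * B (G m) p" unfolding r_def add smult ..
      ultimately show ?case using comm[of p q] by simp
    qed
    from this[of n] have "B p q = 0" if "degree q < n" for q
      using that by (simp add: coeff_eq_0)
    then show ?case using dp cn by (auto simp: P_def)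
  qed
  then have "\<forall>n. \<exists>p. P n p" by blast
  from choice[OF this] obtain G where G: "P n (G n)" for n by blast
  have "geg_int \<gamma> (\<lambda>x. poly (G j) x * poly (G k) x) = 0" if "j \<noteq> k" for j k
    using G[of j] G[of k] that comm[of "G j" "G k"]
    by (cases j k rule: linorder_cases) (auto simp: P_def B_def)
  moreover have "G k \<noteq> 0 \<and> degree (G k) = k" for k using G[of k] by (auto simp: P_def)
  ultimately show ?thesis unfolding gegenbauer_polys_def by blast
qed

end

theory Submission
  imports Defs
begin

text \<open>Write \<open>L p\<close> for the integral of \<open>p W\<close> over \<open>(-1, 1)\<close>, and \<open>P\<^sub>m\<close> for the polynomials of degree at
  most \<open>m\<close>. Both methods turn out to say, for a clamped \<open>u\<close> of degree at most \<open>n\<close>, that the residual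
  \<open>R = \<lambda> D\<^sup>2u - D\<^sup>4u\<close> is a combination of \<open>D\<^sup>2G\<^bsub>n-1\<^esub>\<close> and \<open>D\<^sup>2G\<^sub>n\<close>.

  For the tau method, both \<open>D\<^sup>2v\<close> and \<open>D\<^sup>2u\<close> lie in \<open>P\<^bsub>n-2\<^esub>\<close>, so the two orthogonality conditions together force
  \<open>D\<^sup>2v = \<lambda> D\<^sup>2u\<close> exactly. With \<open>e = D\<^sup>2u - v\<close>, which is orthogonal to \<open>P\<^bsub>n-2\<^esub>\<close> and hence a combination of
  \<open>G\<^bsub>n-1\<^esub>\<close> and \<open>G\<^sub>n\<close>, this reads \<open>R = -D\<^sup>2e\<close>.

  The link with the Galerkin method is that \<open>D\<^sup>2\<close>, paired with test functions \<open>(1 - x\<^sup>2)\<^sup>2q\<close>, has an adjoint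
  with respect to \<open>L\<close> which is a polynomial operator raising degrees by at most two
  (\<open>geg_functional_second_deriv\<close>): the factor \<open>(1 - x\<^sup>2)\<^sup>2\<close> removes the boundary terms of two integrations by
  parts and makes up for the two derivatives that fall on the weight. So if \<open>e\<close> is orthogonal to
  \<open>P\<^bsub>n-2\<^esub>\<close>, then \<open>D\<^sup>2e\<close> is orthogonal to \<open>(1 - x\<^sup>2)\<^sup>2P\<^bsub>n-4\<^esub>\<close>, which is the Galerkin condition. Conversely,
  subtracting suitable multiples of \<open>D\<^sup>2G\<^bsub>n-1\<^esub>\<close> and \<open>D\<^sup>2G\<^sub>n\<close> from a Galerkin residual leaves an element of
  \<open>P\<^bsub>n-4\<^esub>\<close> orthogonal to \<open>(1 - x\<^sup>2)\<^sup>2P\<^bsub>n-4\<^esub>\<close>, which vanishes by positivity of the weight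
  (\<open>galerkin_residual_expansion\<close>); then \<open>v\<close> is \<open>D\<^sup>2u\<close> plus the same combination of \<open>G\<^bsub>n-1\<^esub>\<close>
  and \<open>G\<^sub>n\<close>.\<close>

section \<open>The weighted integral as a linear functional on polynomials\<close>

definition geg_functional :: "real \<Rightarrow> complex poly \<Rightarrow> complex" where
  "geg_functional \<gamma> p = geg_int \<gamma> (\<lambda>x. poly p (of_real x))"

definition complex_poly :: "real poly \<Rightarrow> complex poly" where
  "complex_poly = map_poly of_real"

lemma coeff_complex_poly [simp]: "coeff (complex_poly p) i = of_real (coeff p i)"
  by (simp add: complex_poly_def coeff_map_poly)

lemma degree_complex_poly [simp]: "degree (complex_poly p) = degree p"
  unfolding complex_poly_def by (rule degree_map_poly) simp

lemma poly_complex_poly [simp]: "poly (complex_poly p) (of_real x) = of_real (poly p x)"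
  unfolding complex_poly_def by (induction p) (simp_all add: map_poly_pCons)

lemma poly_of_real_decompose:
  fixes p :: "complex poly"
  shows "poly p (of_real x) = of_real (poly (map_poly Re p) x) + \<i> * of_real (poly (map_poly Im p) x)"
  by (induction p) (simp_all add: map_poly_pCons complex_eq_iff algebra_simps)

lemma set_integrable_geg_poly:
  fixes p :: "complex poly"
  assumes "\<gamma> > -1/2"
  shows "set_integrable lborel {-1<..<1} (\<lambda>x. geg_weight \<gamma> x *\<^sub>R poly p (of_real x))"
  using assms by (rule set_integrable_geg_int) (intro continuous_intros)

lemma geg_functional_add:
  assumes "\<gamma> > -1/2"
  shows "geg_functional \<gamma> (p + q) = geg_functional \<gamma> p + geg_functional \<gamma> q"
  unfolding geg_functional_def geg_int_def
  using set_integral_add(2)[OF set_integrable_geg_poly[OF assms, of p] set_integrable_geg_poly[OF assms, of q]]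
  by (simp add: scaleR_right_distrib)

lemma geg_functional_smult: "geg_functional \<gamma> (smult c p) = c * geg_functional \<gamma> p"
proof -
  have "geg_functional \<gamma> (smult c p)
      = (LINT x:{-1<..<1}|lborel. c * (geg_weight \<gamma> x *\<^sub>R poly p (of_real x)))"
    unfolding geg_functional_def geg_int_def by simp
  also have "\<dots> = c * geg_functional \<gamma> p"
    unfolding geg_functional_def geg_int_def by (rule set_integral_mult_right)
  finally show ?thesis .
qed

lemma geg_functional_0 [simp]: "geg_functional \<gamma> 0 = 0"
  using geg_functional_smult[of \<gamma> 0 0] by simp

lemma geg_functional_diff:
  assumes "\<gamma> > -1/2"
  shows "geg_functional \<gamma> (p - q) = geg_functional \<gamma> p - geg_functional \<gamma> q"
  using geg_functional_add[OF assms, of p "smult (-1) q"] geg_functional_smult[of \<gamma> "-1" q] by simp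

section \<open>Integration by parts against the Gegenbauer weight\<close>

text \<open>The derivative of \<open>(1 - x\<^sup>2) W r\<close>, divided by \<open>W\<close>. Staying with the single weight \<open>W\<close>
  keeps all later identities inside the polynomials.\<close>

definition geg_div :: "real \<Rightarrow> complex poly \<Rightarrow> complex poly" where
  "geg_div \<gamma> r = [:1, 0, -1:] * pderiv r - [:0, of_real (2 * \<gamma> + 1):] * r"

lemma degree_geg_div: "degree (geg_div \<gamma> r) \<le> Suc (degree r)"
proof -
  have "degree ([:1, 0, -1:] * pderiv r) \<le> Suc (degree r)"
  proof (cases "degree r = 0")
    case True
    then have "pderiv r = 0" by (simp add: pderiv_eq_0_iff)
    then show ?thesis by simp
  next
    case False
    have "degree ([:1, 0, -1:] * pderiv r) \<le> degree [:1, 0, -1::complex:] + degree (pderiv r)"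
      by (rule degree_mult_le)
    with False show ?thesis by (simp add: degree_pderiv)
  qed
  moreover have "degree ([:0, of_real (2 * \<gamma> + 1):] * r) \<le> Suc (degree r)"
    by (rule order.trans[OF degree_mult_le]) simp
  ultimately show ?thesis unfolding geg_div_def by (rule degree_diff_le)
qed

text \<open>The integrand is the derivative of \<open>(1 - x\<^sup>2) W r\<close>, that is, of \<open>(1 - x\<^sup>2)\<close> to the power
  \<open>\<gamma> + 1/2 > 0\<close> times \<open>r\<close>, which is continuous on \<open>[-1, 1]\<close> and zero at both ends.\<close>

lemma geg_functional_geg_div:
  assumes "\<gamma> > -1/2"
  shows "geg_functional \<gamma> (geg_div \<gamma> r) = 0"
proof -
  define F where "F x = (1 - x\<^sup>2) powr (\<gamma> + 1/2) *\<^sub>R poly r (of_real x)" for x :: real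
  define f where "f x = geg_weight \<gamma> x *\<^sub>R poly (geg_div \<gamma> r) (of_real x)" for x :: real
  have "(f has_integral (F 1 - F (-1))) {-1..1}"
  proof (rule fundamental_theorem_of_calculus_interior)
    show "continuous_on {-1..1} F"
      unfolding F_def using assms
      by (intro continuous_intros continuous_on_powr') (auto simp: abs_square_le_1 abs_le_iff)
  next
    fix x :: real assume x: "x \<in> {-1<..<1}"
    then have "\<bar>x\<bar> < 1" by auto
    then have pos: "1 - x\<^sup>2 > 0" by (simp add: abs_square_less_1)
    have poly: "((\<lambda>x. poly r (of_real x)) has_vector_derivative poly (pderiv r) (of_real x)) (at x)"
      using field_vector_diff_chain_at[of of_real 1 x "poly r" "poly (pderiv r) (of_real x)"]
        poly_DERIV[of r "of_real x"] has_vector_derivative_of_real[OF DERIV_ident, of "at x"]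
      by (simp add: o_def)
    have "((\<lambda>x. (1 - x\<^sup>2) powr (\<gamma> + 1/2)) has_real_derivative
            (\<gamma> + 1/2) * (1 - x\<^sup>2) powr (\<gamma> + 1/2 - 1) * (- 2 * x)) (at x)"
      using pos by (auto intro!: derivative_eq_intros)
    then have weight: "((\<lambda>x. (1 - x\<^sup>2) powr (\<gamma> + 1/2)) has_real_derivative
            - (2 * \<gamma> + 1) * x * geg_weight \<gamma> x) (at x)"
      by (simp add: geg_weight_def algebra_simps)
    have "(1 - x\<^sup>2) powr (\<gamma> + 1/2) = (1 - x\<^sup>2) * geg_weight \<gamma> x"
      using pos powr_mult_base[of "1 - x\<^sup>2" "\<gamma> - 1/2"] by (simp add: geg_weight_def algebra_simps)
    then have "(1 - x\<^sup>2) powr (\<gamma> + 1/2) *\<^sub>R poly (pderiv r) (of_real x)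
                 + (- (2 * \<gamma> + 1) * x * geg_weight \<gamma> x) *\<^sub>R poly r (of_real x) = f x"
      by (simp only:) (simp add: f_def geg_div_def scaleR_conv_of_real power2_eq_square algebra_simps)
    with has_vector_derivative_scaleR[OF weight poly]
    show "(F has_vector_derivative f x) (at x)"
      unfolding F_def by simp
  qed simp
  then have "(f has_integral 0) {-1<..<1}"
    by (simp add: F_def has_integral_Icc_iff_Ioo)
  moreover have "geg_functional \<gamma> (geg_div \<gamma> r) = integral {-1<..<1} f"
    unfolding geg_functional_def geg_int_def f_def
    by (rule set_borel_integral_eq_integral(2)[OF set_integrable_geg_poly[OF assms]])
  ultimately show ?thesis by (simp add: integral_unique)
qed

text \<open>Two integrations by parts give \<open>D\<^sup>2((1 - x\<^sup>2)\<^sup>2 W q) / W\<close>. The correction \<open>-2x q\<close> appears in the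
  inner step because there a factor \<open>1 - x\<^sup>2\<close> is differentiated along with \<open>q\<close>.\<close>

definition geg_adjoint :: "real \<Rightarrow> complex poly \<Rightarrow> complex poly" where
  "geg_adjoint \<gamma> q = geg_div \<gamma> (geg_div \<gamma> q - [:0, 2:] * q)"

lemma degree_geg_adjoint: "degree (geg_adjoint \<gamma> q) \<le> degree q + 2"
proof -
  have "degree ([:0, 2:] * q) \<le> Suc (degree q)"
    by (rule order.trans[OF degree_mult_le]) simp
  then have "degree (geg_div \<gamma> q - [:0, 2:] * q) \<le> Suc (degree q)"
    by (intro degree_diff_le degree_geg_div)
  with degree_geg_div[of \<gamma> "geg_div \<gamma> q - [:0, 2:] * q"] show ?thesis
    unfolding geg_adjoint_def by linarith
qed

text \<open>With \<open>w = 1 - x\<^sup>2\<close> and \<open>s\<close> the inner polynomial of the adjoint, the difference of the two arguments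
  of \<open>L\<close> is \<open>geg_div\<close> of \<open>Dp w q\<close> minus \<open>geg_div\<close> of \<open>p s\<close>, the terms containing \<open>Dp\<close> cancelling.\<close>

lemma geg_functional_second_deriv:
  assumes "\<gamma> > -1/2"
  shows "geg_functional \<gamma> (pderiv (pderiv p) * ([:1, 0, -1:]\<^sup>2 * q)) = geg_functional \<gamma> (p * geg_adjoint \<gamma> q)"
proof -
  define w :: "complex poly" where "w = [:1, 0, -1:]"
  define c :: "complex poly" where "c = [:0, of_real (2 * \<gamma> + 1):]"
  define s where "s = geg_div \<gamma> q - [:0, 2:] * q"
  have w': "pderiv w = - [:0, 2:]" by (simp add: w_def pderiv_pCons)
  have div: "geg_div \<gamma> r = w * pderiv r - c * r" for r
    by (simp add: geg_div_def w_def c_def)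
  have s: "s = w * pderiv q + pderiv w * q - c * q" by (simp add: s_def div w' algebra_simps)
  have "geg_div \<gamma> (pderiv p * (w * q)) - geg_div \<gamma> (p * s)
      = pderiv (pderiv p) * (w\<^sup>2 * q) - p * geg_div \<gamma> s"
    unfolding div by (simp add: s pderiv_mult pderiv_add pderiv_diff power2_eq_square algebra_simps)
  then have "geg_functional \<gamma> (pderiv (pderiv p) * (w\<^sup>2 * q) - p * geg_div \<gamma> s) = 0"
    using geg_functional_diff[OF assms, of "geg_div \<gamma> (pderiv p * (w * q))" "geg_div \<gamma> (p * s)"]
    by (simp add: geg_functional_geg_div[OF assms])
  then show ?thesis
    using assms by (simp add: geg_functional_diff geg_adjoint_def s_def w_def)
qed

section \<open>Orthogonality\<close>

lemma geg_int_of_real: "geg_int \<gamma> (\<lambda>x. complex_of_real (f x)) = of_real (geg_int \<gamma> f)"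
  unfolding geg_int_def
  by (subst set_integral_complex_of_real[symmetric]) (simp add: scaleR_conv_of_real)

text \<open>The pairing is bilinear, so positivity is not available for complex \<open>S\<close> as such. Testing
  with the real polynomials \<open>Re S\<close> and \<open>Im S\<close> and taking the real respectively imaginary part of
  the result gives \<open>L ((a Re S)\<^sup>2) = 0\<close> and \<open>L ((a Im S)\<^sup>2) = 0\<close>. The factor \<open>a\<close> is \<open>1\<close> for the tau
  conditions and \<open>1 - x\<^sup>2\<close> for the Galerkin condition.\<close>

lemma geg_functional_nondegenerate:
  fixes a :: "real poly"
  assumes "\<gamma> > -1/2" and "a \<noteq> 0"
    and orth: "\<And>q. degree q \<le> degree S \<Longrightarrow> geg_functional \<gamma> (S * ((complex_poly a)\<^sup>2 * q)) = 0"
  shows "S = 0"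
proof -
  let ?R = "map_poly Re S" and ?I = "map_poly Im S"
  have degree_re: "degree ?R \<le> degree S" and degree_im: "degree ?I \<le> degree S"
    by (auto intro!: degree_le simp: coeff_map_poly coeff_eq_0)
  have real: "geg_functional \<gamma> (complex_poly p) = of_real (geg_int \<gamma> (\<lambda>x. poly p x))" for p
    using geg_int_of_real[of \<gamma> "poly p"] by (simp add: geg_functional_def)
  have split: "geg_functional \<gamma> (S * ((complex_poly a)\<^sup>2 * complex_poly q))
      = of_real (geg_int \<gamma> (\<lambda>x. poly (?R * a\<^sup>2 * q) x)) + \<i> * of_real (geg_int \<gamma> (\<lambda>x. poly (?I * a\<^sup>2 * q) x))"
    (is "?L = of_real ?A + \<i> * of_real ?B") for q
  proof -
    have "?L = geg_functional \<gamma> (complex_poly (?R * a\<^sup>2 * q) + smult \<i> (complex_poly (?I * a\<^sup>2 * q)))"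
      unfolding geg_functional_def
      by (intro arg_cong[where f = "geg_int \<gamma>"] ext)
         (simp add: poly_of_real_decompose[of S] algebra_simps)
    also have "\<dots> = geg_functional \<gamma> (complex_poly (?R * a\<^sup>2 * q)) + \<i> * geg_functional \<gamma> (complex_poly (?I * a\<^sup>2 * q))"
      using assms(1) by (simp add: geg_functional_add geg_functional_smult)
    finally show ?thesis by (simp only: real)
  qed
  have vanish: "p = 0" if "geg_int \<gamma> (\<lambda>x. poly (p * a\<^sup>2 * p) x) = 0" for p
  proof -
    have "geg_int \<gamma> (\<lambda>x. poly (a * p) x * poly (a * p) x) = 0"
      using that by (simp add: power2_eq_square mult_ac)
    then have "a * p = 0" by (rule geg_int_square_eq_0[OF assms(1)])
    with \<open>a \<noteq> 0\<close> show ?thesis by simp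
  qed
  have "?R = 0"
    using split[of ?R] orth[of "complex_poly ?R"] degree_re
    by (intro vanish) (simp add: complex_eq_iff)
  moreover have "?I = 0"
    using split[of ?I] orth[of "complex_poly ?I"] degree_im
    by (intro vanish) (simp add: complex_eq_iff)
  ultimately show "S = 0"
    by (metis coeff_0 coeff_map_poly complex_eq_iff poly_eqI zero_complex.simps)
qed

text \<open>Polynomials with one of each degree up to \<open>m\<close> span those of degree at most \<open>m\<close>: cancel leading
  terms and recurse on the degree.\<close>

lemma orthogonal_extend:
  assumes "\<gamma> > -1/2"
    and G: "\<And>k. k \<le> m \<Longrightarrow> G k \<noteq> 0 \<and> degree (G k) = k"
    and orth: "\<And>k. k \<le> m \<Longrightarrow> geg_functional \<gamma> (e * G k) = 0"
    and "degree q \<le> m"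
  shows "geg_functional \<gamma> (e * q) = 0"
  using assms(4)
proof (induction "degree q" arbitrary: q rule: less_induct)
  case less
  define g where "g = G (degree q)"
  have g: "g \<noteq> 0" "degree g = degree q" "geg_functional \<gamma> (e * g) = 0"
    using G orth less.prems by (auto simp: g_def)
  define c where "c = lead_coeff q / lead_coeff g"
  define r where "r = q - smult c g"
  have "coeff g (degree q) \<noteq> 0" using g by (metis leading_coeff_0_iff)
  then have "coeff r (degree q) = 0" using g(2) by (simp add: r_def c_def)
  moreover have "degree r \<le> degree q"
    unfolding r_def using g by (intro degree_diff_le) auto
  ultimately have "r = 0 \<or> degree r < degree q"
    by (metis leading_coeff_0_iff order_le_imp_less_or_eq)
  then have "geg_functional \<gamma> (e * r) = 0"
    using less by auto
  moreover have "e * q = e * r + smult c (e * g)" by (simp add: r_def algebra_simps)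
  ultimately show ?case
    using assms(1) g by (simp add: geg_functional_add geg_functional_smult)
qed

text \<open>This rephrases the tau conditions without reference to the choice of \<open>G\<close>.\<close>

lemma gegenbauer_orth_iff:
  assumes "\<gamma> > -1/2" and "gegenbauer_polys \<gamma> G"
  shows "(\<forall>k\<le>m. geg_int \<gamma> (\<lambda>x. poly e (of_real x) * of_real (poly (G k) x)) = 0) \<longleftrightarrow>
         (\<forall>q. degree q \<le> m \<longrightarrow> geg_functional \<gamma> (e * q) = 0)"
proof -
  have *: "geg_int \<gamma> (\<lambda>x. poly e (of_real x) * of_real (poly (G k) x))
      = geg_functional \<gamma> (e * complex_poly (G k))" for k
    by (simp add: geg_functional_def)
  have G: "complex_poly (G k) \<noteq> 0 \<and> degree (complex_poly (G k)) = k" for k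
    using assms(2) degree_complex_poly[of "G k"]
    by (auto simp: gegenbauer_polys_def poly_eq_iff)
  show ?thesis
    unfolding * using G orthogonal_extend[OF assms(1), of m "\<lambda>k. complex_poly (G k)" e] by auto
qed

lemma gegenbauer_lower_degree:
  assumes "\<gamma> > -1/2" and "gegenbauer_polys \<gamma> G" and "degree q < k"
  shows "geg_functional \<gamma> (complex_poly (G k) * q) = 0"
proof -
  have "geg_int \<gamma> (\<lambda>x. poly (complex_poly (G k)) (of_real x) * of_real (poly (G j) x)) = 0"
    if "j < k" for j
    using assms(2) that geg_int_of_real[of \<gamma> "\<lambda>x. poly (G k) x * poly (G j) x"]
    by (simp add: gegenbauer_polys_def)
  then show ?thesis
    using gegenbauer_orth_iff[OF assms(1,2), of "k - 1" "complex_poly (G k)"] assms(3) by auto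
qed

section \<open>Equivalence of the two methods\<close>

lemma degree_pderiv2: "degree (pderiv (pderiv p)) \<le> degree p - 2" for p :: "complex poly"
  by (simp add: degree_pderiv)

text \<open>Up to constants \<open>D\<^sup>2G\<^bsub>n-1\<^esub>\<close> and \<open>D\<^sup>2G\<^sub>n\<close> are Gegenbauer polynomials of index \<open>\<gamma> + 2\<close> and degrees
  \<open>n - 3\<close> and \<open>n - 2\<close>, so they span the orthogonal complement of \<open>P\<^bsub>n-4\<^esub>\<close> in \<open>P\<^bsub>n-2\<^esub>\<close> for the weight
  \<open>(1 - x\<^sup>2)\<^sup>2 W\<close>. That they lie in this complement follows by moving \<open>D\<^sup>2\<close> to the test function, and
  that they exhaust it by comparing leading coefficients.\<close>

lemma galerkin_residual_expansion:
  assumes "\<gamma> > -1/2" and "gegenbauer_polys \<gamma> G" and "n \<ge> 4" and "degree R \<le> n - 2"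
    and orth: "\<And>q. degree q \<le> n - 4 \<Longrightarrow> geg_functional \<gamma> (R * ([:1, 0, -1:]\<^sup>2 * q)) = 0"
  obtains c d where
    "R = pderiv (pderiv (smult c (complex_poly (G (n - 1))) + smult d (complex_poly (G n))))"
proof -
  define A where "A = pderiv (pderiv (complex_poly (G (n - 1))))"
  define B where "B = pderiv (pderiv (complex_poly (G n)))"
  obtain m where n: "n = m + 4" using \<open>n \<ge> 4\<close> by (metis add.commute le_Suc_ex)
  have lead: "coeff (G k) k \<noteq> 0" and deg: "degree (G k) = k" for k
    using assms(2) unfolding gegenbauer_polys_def by (metis leading_coeff_0_iff)+
  have coeff2: "coeff (pderiv (pderiv p)) i = of_nat (Suc i * Suc (Suc i)) * coeff p (i + 2)"
    for p :: "complex poly" and i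
    by (simp add: coeff_pderiv algebra_simps)
  have A: "coeff A (m + 1) \<noteq> 0" "coeff A (m + 2) = 0"
    using lead[of "m + 3"] deg[of "m + 3"]
    by (simp_all add: A_def n coeff2 numeral_3_eq_3 coeff_eq_0 del: of_nat_mult of_nat_Suc mult_Suc)
  have B: "coeff B (m + 2) \<noteq> 0"
    using lead[of "m + 4"]
    by (simp add: B_def n coeff2 eval_nat_numeral del: of_nat_mult of_nat_Suc mult_Suc)
  \<comment> \<open>The system for cancelling the coefficients in degrees \<open>m + 2 = n - 2\<close> and \<open>m + 1 = n - 3\<close> is
    triangular, since \<open>A\<close> does not reach degree \<open>m + 2\<close>.\<close>
  define d where "d = coeff R (m + 2) / coeff B (m + 2)"
  define c where "c = (coeff R (m + 1) - d * coeff B (m + 1)) / coeff A (m + 1)"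
  define S where "S = R - (smult c A + smult d B)"
  have S: "coeff S (m + 1) = 0" "coeff S (m + 2) = 0"
    using A B by (simp_all add: S_def c_def d_def)
  have "degree A \<le> m + 2" "degree B \<le> m + 2"
    unfolding A_def B_def using degree_pderiv2[of "complex_poly (G (n - 1))"]
      degree_pderiv2[of "complex_poly (G n)"] deg by (simp_all add: n)
  moreover have "degree R \<le> m + 2" using assms(4) by (simp add: n)
  ultimately have "degree S \<le> m + 2"
    unfolding S_def by (intro degree_diff_le degree_add_le) (auto intro: order.trans[OF degree_smult_le])
  have "degree S \<le> m"
  proof (rule degree_le, intro allI impI)
    fix i assume "m < i"
    then consider "i = m + 1" | "i = m + 2" | "i > m + 2" by linarith
    then show "coeff S i = 0" using S \<open>degree S \<le> m + 2\<close> by cases (auto intro: coeff_eq_0)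
  qed
  have "S = 0"
  proof (rule geg_functional_nondegenerate[OF assms(1), of "[:1, 0, -1:]"])
    fix q :: "complex poly" assume "degree q \<le> degree S"
    with \<open>degree S \<le> m\<close> have q: "degree q \<le> m" by simp
    have G: "geg_functional \<gamma> (pderiv (pderiv (complex_poly (G k))) * ([:1, 0, -1:]\<^sup>2 * q)) = 0"
      if "k \<ge> n - 1" for k
      using that q degree_geg_adjoint[of \<gamma> q]
      by (simp only: geg_functional_second_deriv[OF assms(1)])
         (intro gegenbauer_lower_degree[OF assms(1,2)], simp add: n)
    have w: "complex_poly [:1, 0, -1:] = [:1, 0, -1:]"
      by (simp add: complex_poly_def map_poly_pCons)
    have "S * ([:1, 0, -1:]\<^sup>2 * q) = R * ([:1, 0, -1:]\<^sup>2 * q)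
        - (smult c (A * ([:1, 0, -1:]\<^sup>2 * q)) + smult d (B * ([:1, 0, -1:]\<^sup>2 * q)))"
      by (simp add: S_def left_diff_distrib distrib_right)
    then show "geg_functional \<gamma> (S * ((complex_poly [:1, 0, -1:])\<^sup>2 * q)) = 0"
      unfolding w using G[of "n - 1"] G[of n] orth[of q] q assms(1)
      by (simp add: geg_functional_diff geg_functional_add geg_functional_smult A_def B_def n
            del: mult_pCons_left power2_eq_square)
  qed simp
  then have "R = pderiv (pderiv (smult c (complex_poly (G (n - 1))) + smult d (complex_poly (G n))))"
    by (simp add: S_def A_def B_def pderiv_add pderiv_smult)
  then show ?thesis by (rule that)
qed

theorem theorem6p4:
  fixes \<gamma> :: real and n :: nat and G :: "nat \<Rightarrow> real poly"
    and lam :: complex and u :: "complex poly"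
  assumes "\<gamma> > -1/2" and "n \<ge> 4"
    and "gegenbauer_polys \<gamma> G"
    and "u \<noteq> 0" and "degree u \<le> n"
  shows "galerkin_solution \<gamma> n lam u \<longleftrightarrow>
         (\<exists>v. degree v \<le> n \<and> modified_tau_solution \<gamma> G n lam u v)"
proof -
  define D2 :: "complex poly \<Rightarrow> complex poly" where "D2 p = pderiv (pderiv p)" for p
  define R where "R = smult lam (D2 u) - D2 (D2 u)"
  have pow: "(pderiv ^^ 2) p = D2 p" "(pderiv ^^ 4) p = D2 (D2 p)" for p
    by (simp_all add: D2_def eval_nat_numeral)
  have deg: "degree (D2 p) \<le> n - 2" if "degree p \<le> n" for p
    using degree_pderiv2[of p] that by (simp add: D2_def)
  have linear: "D2 (p + q) = D2 p + D2 q" "D2 (p - q) = D2 p - D2 q" for p q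
    by (simp_all add: D2_def pderiv_add pderiv_diff)
  have degR: "degree R \<le> n - 2"
    unfolding R_def using deg[OF \<open>degree u \<le> n\<close>] deg[of "D2 u"]
    by (intro degree_diff_le order.trans[OF degree_smult_le]) auto
  have galerkin: "galerkin_solution \<gamma> n lam u \<longleftrightarrow> clamped u \<and>
      (\<forall>q. degree q \<le> n - 4 \<longrightarrow> geg_functional \<gamma> (R * ([:1, 0, -1:]\<^sup>2 * q)) = 0)"
    using \<open>degree u \<le> n\<close>
    unfolding galerkin_solution_def clamped_iff[OF \<open>n \<ge> 4\<close>] pow R_def geg_functional_def
    by (auto simp: poly_mult)
  have tau: "modified_tau_solution \<gamma> G n lam u v \<longleftrightarrow> degree v \<le> n \<and> clamped u \<and>
      (\<forall>q. degree q \<le> n - 2 \<longrightarrow> geg_functional \<gamma> ((D2 u - v) * q) = 0) \<and>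
      (\<forall>q. degree q \<le> n - 2 \<longrightarrow> geg_functional \<gamma> ((D2 v - smult lam v) * q) = 0)" for v
    using \<open>degree u \<le> n\<close>
    unfolding modified_tau_solution_def pow gegenbauer_orth_iff[OF assms(1,3), symmetric] by blast
  show ?thesis
  proof
    assume "galerkin_solution \<gamma> n lam u"
    then have "clamped u" and orth: "\<And>q. degree q \<le> n - 4 \<Longrightarrow> geg_functional \<gamma> (R * ([:1, 0, -1:]\<^sup>2 * q)) = 0"
      by (auto simp: galerkin)
    obtain c d where R: "R = D2 (smult c (complex_poly (G (n - 1))) + smult d (complex_poly (G n)))"
      unfolding D2_def by (rule galerkin_residual_expansion[OF assms(1,3,2) degR orth])
    define e where "e = smult c (complex_poly (G (n - 1))) + smult d (complex_poly (G n))"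
    \<comment> \<open>\<open>e\<close> is orthogonal to all degrees up to \<open>n - 2\<close>, and adding it makes \<open>D2 v\<close> equal to
      \<open>lam D2 u\<close>; both tau residuals are then multiples of \<open>e\<close>.\<close>
    define v where "v = D2 u + e"
    have "degree e \<le> n"
      unfolding e_def using assms(3)
      by (intro degree_add_le order.trans[OF degree_smult_le]) (auto simp: gegenbauer_polys_def)
    then have "degree v \<le> n"
      unfolding v_def using deg[OF \<open>degree u \<le> n\<close>] by (intro degree_add_le) auto
    have e: "geg_functional \<gamma> (e * q) = 0" if "degree q \<le> n - 2" for q
      using gegenbauer_lower_degree[OF assms(1,3), of q "n - 1"]
        gegenbauer_lower_degree[OF assms(1,3), of q n] that assms(1,2)
      by (simp add: e_def distrib_right geg_functional_add geg_functional_smult)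
    have "D2 v = smult lam (D2 u)"
      using R[folded e_def] by (simp add: v_def linear R_def algebra_simps)
    then have "(D2 u - v) * q = smult (-1) (e * q)" "(D2 v - smult lam v) * q = smult (- lam) (e * q)" for q
      by (simp_all add: v_def smult_add_right)
    with e \<open>clamped u\<close> \<open>degree v \<le> n\<close> have "modified_tau_solution \<gamma> G n lam u v"
      by (simp add: tau geg_functional_smult del: smult_minus_left)
    with \<open>degree v \<le> n\<close> show "\<exists>v. degree v \<le> n \<and> modified_tau_solution \<gamma> G n lam u v" by blast
  next
    assume "\<exists>v. degree v \<le> n \<and> modified_tau_solution \<gamma> G n lam u v"
    then obtain v where v: "degree v \<le> n" "clamped u"
      and e: "\<And>q. degree q \<le> n - 2 \<Longrightarrow> geg_functional \<gamma> ((D2 u - v) * q) = 0"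
      and f: "\<And>q. degree q \<le> n - 2 \<Longrightarrow> geg_functional \<gamma> ((D2 v - smult lam v) * q) = 0"
      by (auto simp: tau)
    \<comment> \<open>\<open>T\<close> is the second residual minus \<open>lam\<close> times the first, a combination of low enough degree to
      be its own test function.\<close>
    define T where "T = D2 v - smult lam (D2 u)"
    have "degree T \<le> n - 2"
      unfolding T_def using deg[OF v(1)] deg[OF \<open>degree u \<le> n\<close>]
      by (intro degree_diff_le order.trans[OF degree_smult_le])
    have "T = 0"
    proof (rule geg_functional_nondegenerate[OF assms(1), of 1])
      fix q :: "complex poly" assume "degree q \<le> degree T"
      then have "degree q \<le> n - 2" using \<open>degree T \<le> n - 2\<close> by simp
      moreover have "T * q = (D2 v - smult lam v) * q - smult lam ((D2 u - v) * q)"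
        by (simp add: T_def left_diff_distrib smult_diff_right)
      moreover have "complex_poly 1 = 1" by (simp add: complex_poly_def)
      ultimately show "geg_functional \<gamma> (T * ((complex_poly 1)\<^sup>2 * q)) = 0"
        using assms(1) e f by (simp add: geg_functional_diff geg_functional_smult)
    qed simp
    then have R: "R = smult (-1) (D2 (D2 u - v))"
      by (simp add: R_def T_def linear)
    have "geg_functional \<gamma> (R * ([:1, 0, -1:]\<^sup>2 * q)) = 0" if "degree q \<le> n - 4" for q
    proof -
      have "degree (geg_adjoint \<gamma> q) \<le> n - 2"
        using degree_geg_adjoint[of \<gamma> q] that \<open>n \<ge> 4\<close> by linarith
      then have "geg_functional \<gamma> (D2 (D2 u - v) * ([:1, 0, -1:]\<^sup>2 * q)) = 0"
        unfolding D2_def[of "D2 u - v"] geg_functional_second_deriv[OF assms(1)] by (rule e)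
      then show ?thesis
        unfolding R by (simp only: mult_smult_left geg_functional_smult) simp
    qed
    with v show "galerkin_solution \<gamma> n lam u" by (simp add: galerkin)
  qed
qed

end
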